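(* Let $\{x^n\}_{n\ge 0}$ be a sequence generated by the CCD algorithm with stepsize $\mu$ for the $l_q$ regularization problem with data $(A,y,\lambda,q)$. Assume that $0<\mu<L_{\max}^{-1}$, $T_\lambda(x^0)<+\infty$, and that $x^*$ is the point to which $\{x^n\}$ converges. Let $I=Supp(x^* )=\{i:x_i^*\ne0\}$ and $K=\|x^*\|_0$ (the number of elements of $I$). Then $x^*$ is a local minimizer of $T_\lambda$ if the following conditions hold: (a) $\sigma_{\min}(A_I^TA_I)>0$; (b) $0<\lambda<\dfrac{\sigma_{\min}(A_I^TA_I)\,|e|^{2-q}}{q(1-q)}$, where $e=\min_{i\in I}|x_i^*|$.
   Context: Let $m,N$ be positive integers, $A\in\mathbb{R}^{m\times N}$ with columns $A_1,\dots,A_N$, $y\in\mathbb{R}^m$, $\lambda>0$, $0<q<1$. The $l_q$ regularization problem is to minimize over $x\in\mathbb{R}^N$ $$T_\lambda(x)=\tfrac12\|Ax-y\|_2^2+\lambda\|x\|_q^q,\qquad \|x\|_q^q=\sum_{i=1}^N|x_i|^q.$$ Set $L_{\max}=\max_i\|A_i\|_2^2$. For an index set $I$, $A_I$ is the submatrix of $A$ formed by the columns indexed by $I$, and $\sigma_{\min}(\cdot)$ denotes the minimal eigenvalue of a square matrix. For $\mu>0$ let $$\eta_{\mu,q}=(2\lambda\mu(1-q))^{\frac1{2-q}},\qquad \tau_{\mu,q}=\frac{2-q}{2-2q}(2\lambda\mu(1-q))^{\frac1{2-q}},$$ and for $z\in\mathbb{R}$ let $prox_{\lambda\mu,q}(z)=\arg\min_{v\in\mathbb{R}}\{\frac{|z-v|^2}{2}+\lambda\mu|v|^q\}$;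 the minimizer is unique unless $|z|=\tau_{\mu,q}$, in which case the minimizers are $0$ and $\mathrm{sgn}(z)\eta_{\mu,q}$. CCD algorithm with stepsize $\mu>0$: start from an arbitrary $x^0\in\mathbb{R}^N$. Given $x^n$ ($n=0,1,2,\dots$), let $i\in\{1,\dots,N\}$ be the index with $i\equiv n+1 \pmod N$, put $z_i^n=x_i^n-\mu A_i^T(Ax^n-y)$, and set $x_i^{n+1}=\mathcal{T}(z_i^n,x_i^n)$ and $x_j^{n+1}=x_j^n$ for $j\ne i$, where $\mathcal{T}(z,t)=prox_{\lambda\mu,q}(z)$ if $|z|\neq\tau_{\mu,q}$, and, if $|z|=\tau_{\mu,q}$, $\mathcal{T}(z,t)=\mathrm{sgn}(z)\eta_{\mu,q}$ when $t\ne0$ and $\mathcal{T}(z,t)=0$ when $t=0$. The sequence is the infinite one obtained without a stopping rule. *)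

theory Defs
  imports
    "Jordan_Normal_Form.Spectral_Radius"
    "Jordan_Normal_Form.DL_Submatrix"
    "HOL-Library.Extended_Real"
begin

text \<open>
  Vectors and matrices are indexed from 0, so the coordinate and column indices
  are \<open>0, \<dots>, N - 1\<close> instead of \<open>1, \<dots>, N\<close>.
\<close>

definition l2_norm :: "real vec \<Rightarrow> real" where
  "l2_norm v = sqrt (v \<bullet> v)"

definition lq_objective :: "real mat \<Rightarrow> real vec \<Rightarrow> real \<Rightarrow> real \<Rightarrow> real vec \<Rightarrow> real" where
  "lq_objective A y lam q x =
     1 / 2 * (l2_norm (A *\<^sub>v x - y))\<^sup>2 + lam * (\<Sum>i<dim_vec x. \<bar>x $ i\<bar> powr q)"

definition L_max :: "real mat \<Rightarrow> real" where
  "L_max A = Max ((\<lambda>i. (l2_norm (col A i))\<^sup>2) ` {..<dim_col A})"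

definition supp :: "real vec \<Rightarrow> nat set" where
  "supp x = {i. i < dim_vec x \<and> x $ i \<noteq> 0}"

definition column_submatrix :: "real mat \<Rightarrow> nat set \<Rightarrow> real mat" where
  "column_submatrix A I = submatrix A UNIV I"

text \<open>
  Only meaningful for a square matrix of positive dimension with a real eigenvalue,
  as is the case for \<open>B = A\<^sub>I\<^sup>T A\<^sub>I\<close> with \<open>I\<close> nonempty.
\<close>

definition sigma_min :: "real mat \<Rightarrow> real" where
  "sigma_min B = Min (spectrum B)"

definition eta :: "real \<Rightarrow> real \<Rightarrow> real \<Rightarrow> real" where
  "eta lam q mu = (2 * lam * mu * (1 - q)) powr (1 / (2 - q))"

definition tau :: "real \<Rightarrow> real \<Rightarrow> real \<Rightarrow> real" where
  "tau lam q mu = (2 - q) / (2 - 2 * q) * (2 * lam * mu * (1 - q)) powr (1 / (2 - q))"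

text \<open>
  The minimizer is unique unless \<open>\<bar>z\<bar> = tau lam q mu\<close>; \<open>prox\<close> is only used away from
  these two points.
\<close>

definition prox :: "real \<Rightarrow> real \<Rightarrow> real \<Rightarrow> real \<Rightarrow> real" where
  "prox lam q mu z = arg_min (\<lambda>v. \<bar>z - v\<bar>\<^sup>2 / 2 + lam * mu * \<bar>v\<bar> powr q) (\<lambda>_. True)"

definition threshold :: "real \<Rightarrow> real \<Rightarrow> real \<Rightarrow> real \<Rightarrow> real \<Rightarrow> real" where
  "threshold lam q mu z t =
     (if \<bar>z\<bar> \<noteq> tau lam q mu then prox lam q mu z
      else if t \<noteq> 0 then sgn z * eta lam q mu
      else 0)"

definition ccd_step ::
  "real mat \<Rightarrow> real vec \<Rightarrow> real \<Rightarrow> real \<Rightarrow> real \<Rightarrow> nat \<Rightarrow> real vec \<Rightarrow> real vec" where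
  "ccd_step A y lam q mu i x =
     (let z = x $ i - mu * (col A i \<bullet> (A *\<^sub>v x - y))
      in x |\<^sub>v i \<mapsto> threshold lam q mu z (x $ i))"

text \<open>
  With 1-based indices, step \<open>n\<close> updates the coordinate congruent to \<open>n + 1\<close> modulo
  \<open>N\<close>; with 0-based indices this is coordinate \<open>n mod N\<close>.
\<close>

definition ccd_sequence ::
  "real mat \<Rightarrow> real vec \<Rightarrow> real \<Rightarrow> real \<Rightarrow> real \<Rightarrow> (nat \<Rightarrow> real vec) \<Rightarrow> bool" where
  "ccd_sequence A y lam q mu x \<longleftrightarrow>
     x 0 \<in> carrier_vec (dim_col A) \<and>
     (\<forall>n. x (Suc n) = ccd_step A y lam q mu (n mod dim_col A) (x n))"

definition vec_converges_to :: "(nat \<Rightarrow> real vec) \<Rightarrow> real vec \<Rightarrow> bool" where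
  "vec_converges_to x a \<longleftrightarrow> (\<lambda>n. l2_norm (x n - a)) \<longlonglongrightarrow> 0"

definition local_minimizer :: "nat \<Rightarrow> (real vec \<Rightarrow> real) \<Rightarrow> real vec \<Rightarrow> bool" where
  "local_minimizer N f a \<longleftrightarrow>
     a \<in> carrier_vec N \<and>
     (\<exists>\<epsilon>>0. \<forall>u\<in>carrier_vec N. l2_norm (u - a) < \<epsilon> \<longrightarrow> f a \<le> f u)"

end

theory Submission
  imports Defs
begin

text \<open>
  At a step that updates coordinate \<open>i\<close>, the new value, if nonzero, is a critical point of
  \<open>v \<mapsto> \<bar>z - v\<bar>\<^sup>2 / 2 + lam * mu * \<bar>v\<bar> powr q\<close>, also in the ambiguous case \<open>\<bar>z\<bar> = tau lam q mu\<close>. In the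
  limit this makes \<open>xstar\<close> stationary for the objective in every coordinate of its support. On the
  support, condition (b) says that the curvature of the quadratic part exceeds the concavity of the
  penalty; off the support, \<open>\<bar>t\<bar> powr q\<close> with \<open>q < 1\<close> dominates every linear perturbation.
\<close>

section \<open>Euclidean norm and boundedness of linear maps\<close>

lemma scalar_prod_self_nonneg: "0 \<le> v \<bullet> (v :: real vec)"
  by (auto simp: scalar_prod_def intro: sum_nonneg)

lemma l2_norm_power2: "(l2_norm v)\<^sup>2 = v \<bullet> v"
  by (simp add: l2_norm_def scalar_prod_self_nonneg)

lemma abs_index_le_l2_norm:
  assumes "i < dim_vec v"
  shows "\<bar>v $ i\<bar> \<le> l2_norm v"
proof -
  have "(v $ i)\<^sup>2 \<le> (\<Sum>j = 0..<dim_vec v. (v $ j)\<^sup>2)"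
    using assms by (intro member_le_sum) auto
  also have "\<dots> = v \<bullet> v"
    by (simp add: scalar_prod_def power2_eq_square)
  finally show ?thesis
    using real_le_rsqrt[of "\<bar>v $ i\<bar>"] by (simp add: l2_norm_def)
qed

text \<open>The triangle inequality in each row, with every entry of \<open>v\<close> bounded by its
  norm, gives a crude operator bound. Only its existence matters. The summand 1 in \<open>C\<close>
  makes the constant strictly positive even for a zero matrix.\<close>

lemma mult_mat_vec_bounded:
  fixes M :: "real mat"
  assumes M: "M \<in> carrier_mat m n"
  shows "\<exists>C>0. \<forall>v\<in>carrier_vec n. (M *\<^sub>v v) \<bullet> (M *\<^sub>v v) \<le> C * (v \<bullet> v)"
proof -
  define C where "C = 1 + (\<Sum>i = 0..<m. (\<Sum>j = 0..<n. \<bar>M $$ (i, j)\<bar>)\<^sup>2)"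
  have "0 < C"
    unfolding C_def by (rule add_pos_nonneg) (auto intro: sum_nonneg)
  moreover have "(M *\<^sub>v v) \<bullet> (M *\<^sub>v v) \<le> C * (v \<bullet> v)" if v: "v \<in> carrier_vec n" for v
  proof -
    have row: "((M *\<^sub>v v) $ i)\<^sup>2 \<le> (\<Sum>j = 0..<n. \<bar>M $$ (i, j)\<bar>)\<^sup>2 * (v \<bullet> v)" if "i < m" for i
    proof -
      have "\<bar>(M *\<^sub>v v) $ i\<bar> = \<bar>\<Sum>j = 0..<n. M $$ (i, j) * v $ j\<bar>"
        using that M v by (simp add: scalar_prod_def)
      also have "\<dots> \<le> (\<Sum>j = 0..<n. \<bar>M $$ (i, j)\<bar> * \<bar>v $ j\<bar>)"
        by (rule order_trans[OF sum_abs]) (simp add: abs_mult)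
      also have "\<dots> \<le> (\<Sum>j = 0..<n. \<bar>M $$ (i, j)\<bar> * l2_norm v)"
        using v by (intro sum_mono mult_left_mono abs_index_le_l2_norm) auto
      also have "\<dots> = (\<Sum>j = 0..<n. \<bar>M $$ (i, j)\<bar>) * l2_norm v"
        by (simp add: sum_distrib_right)
      finally have "\<bar>(M *\<^sub>v v) $ i\<bar>\<^sup>2 \<le> ((\<Sum>j = 0..<n. \<bar>M $$ (i, j)\<bar>) * l2_norm v)\<^sup>2"
        by (rule power_mono) simp
      then show ?thesis
        by (simp add: power_mult_distrib l2_norm_power2)
    qed
    have "(M *\<^sub>v v) \<bullet> (M *\<^sub>v v) = (\<Sum>i = 0..<m. ((M *\<^sub>v v) $ i)\<^sup>2)"
      using M by (simp add: scalar_prod_def[of "M *\<^sub>v v" "M *\<^sub>v v"] power2_eq_square)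
    also have "\<dots> \<le> (\<Sum>i = 0..<m. (\<Sum>j = 0..<n. \<bar>M $$ (i, j)\<bar>)\<^sup>2 * (v \<bullet> v))"
      by (intro sum_mono row) auto
    also have "\<dots> \<le> C * (v \<bullet> v)"
      by (simp add: C_def sum_distrib_right distrib_right scalar_prod_self_nonneg)
    finally show ?thesis .
  qed
  ultimately show ?thesis by blast
qed

section \<open>Symmetric matrices: smallest eigenvalue and Rayleigh quotient\<close>

lemma scalar_prod_mult_mat_vec_symmetric:
  fixes M :: "real mat"
  assumes M: "M \<in> carrier_mat k k" "transpose_mat M = M"
    and v: "v \<in> carrier_vec k" "w \<in> carrier_vec k"
  shows "(M *\<^sub>v v) \<bullet> w = v \<bullet> (M *\<^sub>v w)"
  using transpose_vec_mult_scalar[OF M(1) v(2) v(1)] M(2)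
  by (simp only:)

text \<open>Nonnegativity of the quadratic form is tested at \<open>v - t M v\<close>, a gradient
  step from \<open>v\<close>; for a suitable \<open>t\<close> the first-order decrease beats the
  second-order term. The bound lets invertibility of \<open>M\<close> pass to a positive lower bound
  for its quadratic form, without diagonalizing \<open>M\<close>.\<close>

lemma psd_norm_square_le:
  fixes M :: "real mat"
  assumes M: "M \<in> carrier_mat k k" and sym: "transpose_mat M = M"
    and psd: "\<And>v. v \<in> carrier_vec k \<Longrightarrow> 0 \<le> v \<bullet> (M *\<^sub>v v)"
  shows "\<exists>C>0. \<forall>v\<in>carrier_vec k. (M *\<^sub>v v) \<bullet> (M *\<^sub>v v) \<le> C * (v \<bullet> (M *\<^sub>v v))"
proof -
  obtain D where D: "0 < D"
    "\<And>v. v \<in> carrier_vec k \<Longrightarrow> (M *\<^sub>v v) \<bullet> (M *\<^sub>v v) \<le> D * (v \<bullet> v)"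
    using mult_mat_vec_bounded[OF M] by blast
  \<comment> \<open>Expanding the square norm of \<open>a - M a\<close> gives
    \<open>2 (a . M a) <= a . a + M a . M a\<close>, and the last term is at most
    \<open>D (a . a)\<close>; hence \<open>a . M a <= C (a . a)\<close>.\<close>
  define C where "C = (1 + D) / 2"
  define t where "t = 1 / C"
  have C: "0 < C" using D by (simp add: C_def)
  have "(M *\<^sub>v v) \<bullet> (M *\<^sub>v v) \<le> C * (v \<bullet> (M *\<^sub>v v))" if v: "v \<in> carrier_vec k" for v
  proof -
    define a where "a = M *\<^sub>v v"
    define b where "b = M *\<^sub>v a"
    have ab: "a \<in> carrier_vec k" "b \<in> carrier_vec k"
      using M v by (auto simp: a_def b_def intro!: mult_mat_vec_carrier)
    have "0 \<le> (v - t \<cdot>\<^sub>v a) \<bullet> (M *\<^sub>v (v - t \<cdot>\<^sub>v a))"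
      using v ab by (intro psd) auto
    also have "M *\<^sub>v (v - t \<cdot>\<^sub>v a) = a - t \<cdot>\<^sub>v b"
      using M v ab by (simp add: mult_minus_distrib_mat_vec[OF M] mult_mat_vec[OF M] a_def b_def)
    also have "(v - t \<cdot>\<^sub>v a) \<bullet> (a - t \<cdot>\<^sub>v b) = v \<bullet> a - t * (v \<bullet> b) - t * (a \<bullet> a) + t * t * (a \<bullet> b)"
      using v ab
      by (simp add: minus_scalar_prod_distrib[of _ k] scalar_prod_minus_distrib[of _ k] algebra_simps)
    also have "v \<bullet> b = a \<bullet> a"
      using scalar_prod_mult_mat_vec_symmetric[OF M sym v ab(1)] by (simp add: a_def b_def)
    finally have 1: "2 * t * (a \<bullet> a) \<le> v \<bullet> a + t * t * (a \<bullet> b)"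
      by simp
    have "0 \<le> (a - b) \<bullet> (a - b)"
      by (rule scalar_prod_self_nonneg)
    also have "(a - b) \<bullet> (a - b) = a \<bullet> a - 2 * (a \<bullet> b) + b \<bullet> b"
      using ab comm_scalar_prod[OF ab]
      by (simp add: minus_scalar_prod_distrib[of _ k] scalar_prod_minus_distrib[of _ k])
    finally have "a \<bullet> b \<le> C * (a \<bullet> a)"
      using D(2)[OF ab(1)] by (simp add: C_def b_def field_simps)
    then have "t * t * (a \<bullet> b) \<le> t * t * (C * (a \<bullet> a))"
      by (intro mult_left_mono) auto
    also have "\<dots> = t * (a \<bullet> a)"
      using C by (simp add: t_def)
    finally have "t * (a \<bullet> a) \<le> v \<bullet> a"
      using 1 by simp
    then show ?thesis
      using C by (simp add: t_def a_def field_simps)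
  qed
  with C show ?thesis by blast
qed

lemma char_matrix_mult_vec:
  fixes B :: "real mat"
  assumes B: "B \<in> carrier_mat k k" and v: "v \<in> carrier_vec k"
  shows "char_matrix B s *\<^sub>v v = B *\<^sub>v v - s \<cdot>\<^sub>v v"
proof -
  have "char_matrix B s *\<^sub>v v = B *\<^sub>v v + ((-s) \<cdot>\<^sub>m 1\<^sub>m k) *\<^sub>v v"
    using B v by (simp add: char_matrix_def add_mult_distrib_mat_vec[of _ k k])
  also have "((-s) \<cdot>\<^sub>m 1\<^sub>m k) *\<^sub>v v = (-s) \<cdot>\<^sub>v v"
    using v by (intro eq_vecI) auto
  finally show ?thesis
    using B v by (intro eq_vecI) auto
qed

text \<open>
  The infimum \<open>s\<close> of the Rayleigh quotient is an eigenvalue: otherwise \<open>B - s\<close> would be positive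
  semidefinite and invertible, hence bounded below by a positive constant.
\<close>

lemma Min_spectrum_le_Rayleigh:
  fixes B :: "real mat"
  assumes B: "B \<in> carrier_mat k k" and sym: "transpose_mat B = B" and k: "0 < k"
    and v: "v \<in> carrier_vec k"
  shows "Min (spectrum B) * (v \<bullet> v) \<le> v \<bullet> (B *\<^sub>v v)"
proof -
  define S where "S = {v \<bullet> (B *\<^sub>v v) | v. v \<in> carrier_vec k \<and> v \<bullet> v = 1}"
  define s where "s = Inf S"
  obtain D where D: "\<And>v. v \<in> carrier_vec k \<Longrightarrow> (B *\<^sub>v v) \<bullet> (B *\<^sub>v v) \<le> D * (v \<bullet> v)"
    using mult_mat_vec_bounded[OF B] by blast
  have "unit_vec k 0 \<bullet> (B *\<^sub>v unit_vec k 0) \<in> S"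
    using k by (auto simp: S_def intro!: exI[of _ "unit_vec k 0"])
  then have ne: "S \<noteq> {}" by blast
  \<comment> \<open>The bound comes from expanding the square norm of \<open>v + B v\<close>; it
    makes the infimum \<open>s\<close> meaningful.\<close>
  have lower: "- (1 + D) / 2 \<le> v \<bullet> (B *\<^sub>v v)" if "v \<in> carrier_vec k" "v \<bullet> v = 1" for v
  proof -
    define w where "w = B *\<^sub>v v"
    have w: "w \<in> carrier_vec k" using B that by (simp add: w_def)
    have "0 \<le> (v + w) \<bullet> (v + w)"
      by (rule scalar_prod_self_nonneg)
    also have "\<dots> = v \<bullet> v + 2 * (v \<bullet> w) + w \<bullet> w"
      using w that comm_scalar_prod[OF w that(1)]
      by (simp add: add_scalar_prod_distrib[of _ k] scalar_prod_add_distrib[of _ k])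
    finally show ?thesis
      using D[OF that(1)] that by (simp add: w_def)
  qed
  have bdd: "bdd_below S"
    unfolding S_def using lower by (intro bdd_belowI[of _ "- (1 + D) / 2"]) auto
  have unit: "s \<le> v \<bullet> (B *\<^sub>v v)" if "v \<in> carrier_vec k" "v \<bullet> v = 1" for v
    unfolding s_def using that by (intro cInf_lower bdd) (auto simp: S_def)
  have ge: "s * (v \<bullet> v) \<le> v \<bullet> (B *\<^sub>v v)" if v: "v \<in> carrier_vec k" for v
  proof (cases "v \<bullet> v = 0")
    case True
    then have "l2_norm v = 0" by (simp add: l2_norm_def)
    then have "v $ i = 0" if "i < k" for i
      using abs_index_le_l2_norm[of i v] that v by auto
    then have "v = 0\<^sub>v k"
      using v by (intro eq_vecI) auto
    then show ?thesis using B by simp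
  next
    case False
    \<comment> \<open>Scaling by \<open>c\<close> puts \<open>v\<close> on the unit sphere, where
      \<open>s\<close> is a lower bound.\<close>
    define c where "c = 1 / l2_norm v"
    have c: "c * c * (v \<bullet> v) = 1"
      using False scalar_prod_self_nonneg[of v] by (simp add: c_def l2_norm_def)
    have "s \<le> (c \<cdot>\<^sub>v v) \<bullet> (B *\<^sub>v (c \<cdot>\<^sub>v v))"
      using v c by (intro unit) (auto simp: mult.assoc)
    also have "\<dots> = c * c * (v \<bullet> (B *\<^sub>v v))"
      using B v by (simp add: mult_mat_vec[OF B v])
    finally have "s * (v \<bullet> v) \<le> c * c * (v \<bullet> (B *\<^sub>v v)) * (v \<bullet> v)"
      by (rule mult_right_mono) (rule scalar_prod_self_nonneg)
    also have "\<dots> = (c * c * (v \<bullet> v)) * (v \<bullet> (B *\<^sub>v v))"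
      by simp
    finally show ?thesis
      unfolding c by simp
  qed
  define M where "M = char_matrix B s"
  have M: "M \<in> carrier_mat k k" using B by (simp add: M_def)
  have Mv: "v \<bullet> (M *\<^sub>v v) = v \<bullet> (B *\<^sub>v v) - s * (v \<bullet> v)" if "v \<in> carrier_vec k" for v
    using B that by (simp add: M_def char_matrix_mult_vec[OF B] scalar_prod_minus_distrib[of _ k])
  have Msym: "transpose_mat M = M"
    proof (intro eq_matI)
    fix i j assume "i < dim_row M" "j < dim_col M"
    then have "i < k" "j < k" using M by auto
    moreover have "B $$ (j, i) = B $$ (i, j)"
      using arg_cong[OF sym, of "\<lambda>X. X $$ (i, j)"] B calculation by simp
    ultimately show "transpose_mat M $$ (i, j) = M $$ (i, j)"
      using B by (simp add: M_def char_matrix_def)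
  qed (use M in auto)
  obtain C where C: "0 < C"
    "\<And>v. v \<in> carrier_vec k \<Longrightarrow> (M *\<^sub>v v) \<bullet> (M *\<^sub>v v) \<le> C * (v \<bullet> (M *\<^sub>v v))"
    using psd_norm_square_le[OF M Msym] Mv ge by force
  have "det M = 0"
  proof (rule ccontr)
    assume "det M \<noteq> 0"
    from det_non_zero_imp_unit[OF M this, of "()"]
    obtain P where P: "P * M = 1\<^sub>m k" "P \<in> carrier_mat k k"
      unfolding Units_def ring_mat_def by auto
    obtain E where E: "0 < E"
      "\<And>v. v \<in> carrier_vec k \<Longrightarrow> (P *\<^sub>v v) \<bullet> (P *\<^sub>v v) \<le> E * (v \<bullet> v)"
      using mult_mat_vec_bounded[OF P(2)] by blast
    \<comment> \<open>An inverse \<open>P\<close> would leave a uniform gap above the infimum: on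
      the unit sphere \<open>1 = |P (M v)|^2 <= E |M v|^2 <= E C (v . M v)\<close>, and
      \<open>v . M v = r - s\<close>.\<close>
    have "s + 1 / (E * C) \<le> r" if r: "r \<in> S" for r
    proof -
      obtain v where v: "v \<in> carrier_vec k" "v \<bullet> v = 1" "r = v \<bullet> (B *\<^sub>v v)"
        using r unfolding S_def by blast
      have "P *\<^sub>v (M *\<^sub>v v) = v"
        using assoc_mult_mat_vec[OF P(2) M v(1)] P(1) v(1) by simp
      then have "1 \<le> E * ((M *\<^sub>v v) \<bullet> (M *\<^sub>v v))"
        using E(2)[of "M *\<^sub>v v"] M v by simp
      also have "\<dots> \<le> E * (C * (v \<bullet> (M *\<^sub>v v)))"
        using C(2)[OF v(1)] E(1) by simp
      finally show ?thesis
        using C(1) E(1) v Mv[OF v(1)] by (simp add: field_simps)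
    qed
    then have "s + 1 / (E * C) \<le> Inf S"
      by (intro cInf_greatest ne)
    moreover have "0 < 1 / (E * C)"
      using C E by simp
    ultimately show False
      by (simp add: s_def)
  qed
  then have "s \<in> spectrum B"
    by (simp add: spectrum_def eigenvalue_det[OF B] M_def)
  then have "Min (spectrum B) \<le> s"
    using card_finite_spectrum(1)[OF B] by simp
  then show ?thesis
    using ge[OF v] scalar_prod_self_nonneg[of v]
    by (meson mult_right_mono order_trans)
qed

section \<open>The scalar proximal problem\<close>

text \<open>\<open>arg_min\<close> is a choice operator, so a minimizer has to be exhibited first.
  The objective is continuous and attains its minimum on a compact interval, outside of which every
  point is at least as bad as 0.\<close>

lemma prox_minimizes:
  assumes "0 < lam" "0 < mu" "0 < q"
  shows "\<bar>z - prox lam q mu z\<bar>\<^sup>2 / 2 + lam * mu * \<bar>prox lam q mu z\<bar> powr q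
    \<le> \<bar>z - v\<bar>\<^sup>2 / 2 + lam * mu * \<bar>v\<bar> powr q"
proof -
  define f where "f = (\<lambda>v. \<bar>z - v\<bar>\<^sup>2 / 2 + lam * mu * \<bar>v\<bar> powr q)"
  \<comment> \<open>For \<open>|v| > 2 |z|\<close> the distance from \<open>v\<close> to
    \<open>z\<close> is at least \<open>|z|\<close>, the distance from 0 to
    \<open>z\<close>.\<close>
  define R where "R = 2 * \<bar>z\<bar>"
  have cont: "isCont f v" for v
    unfolding f_def isCont_def using \<open>0 < q\<close>
    by (intro tendsto_intros tendsto_powr' disjI2) auto
  have "\<exists>a. \<forall>v. - R \<le> v \<and> v \<le> R \<longrightarrow> f a \<le> f v"
    using isCont_eq_Lb[of "-R" R f] cont by (force simp: R_def)
  then obtain a where a: "\<And>v. \<bar>v\<bar> \<le> R \<Longrightarrow> f a \<le> f v"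
    unfolding abs_le_iff by (metis minus_le_iff)
  have "f a \<le> f v" for v
  proof (cases "\<bar>v\<bar> \<le> R")
    case False
    then have "\<bar>z\<bar> \<le> \<bar>z - v\<bar>" by (simp add: R_def)
    then have "f 0 \<le> f v"
      using assms power_mono[of "\<bar>z\<bar>" "\<bar>z - v\<bar>" 2] by (simp add: f_def add_increasing2)
    with a[of 0] show ?thesis by (simp add: R_def)
  qed (rule a)
  then have "is_arg_min f (\<lambda>_. True) a"
    by (simp add: is_arg_min_linorder)
  then have "is_arg_min f (\<lambda>_. True) (prox lam q mu z)"
    unfolding prox_def f_def[symmetric] arg_min_def by (rule someI)
  then have "f (prox lam q mu z) \<le> f v"
    by (simp add: is_arg_min_linorder)
  then show ?thesis by (simp add: f_def)
qed

text \<open>Away from the threshold this is Fermat's rule at a minimizer that is not 0, the only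
  point where the penalty fails to be smooth. At the threshold the value is explicit, and the
  equation is checked by substituting \<open>eta\<close> and \<open>tau\<close>.\<close>

lemma threshold_stationary:
  assumes "0 < lam" "0 < mu" "0 < q" "q < 1"
    and "threshold lam q mu z t = v" "v \<noteq> 0"
  shows "v - z + lam * mu * q * sgn v * \<bar>v\<bar> powr (q - 1) = 0"
proof (cases "\<bar>z\<bar> = tau lam q mu")
  case False
  then have v: "v = prox lam q mu z"
    using assms by (simp add: threshold_def)
  \<comment> \<open>With the sign frozen at that of \<open>v\<close>, \<open>sgn v * w\<close>
    replaces \<open>|w|\<close>. Both agree within distance \<open>|v|\<close> of \<open>v\<close>,
    so \<open>v\<close> is a local minimum of the differentiable \<open>g\<close>.\<close>
  define g where "g = (\<lambda>w. (z - w)\<^sup>2 / 2 + lam * mu * (sgn v * w) powr q)"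
  have pos: "0 < sgn v * v"
    using \<open>v \<noteq> 0\<close> by (simp add: sgn_if)
  have abs_v: "sgn v * v = \<bar>v\<bar>"
    by (simp add: sgn_if)
  have "(g has_real_derivative - (z - v) + lam * mu * (q * (sgn v * v) powr (q - 1) * sgn v)) (at v)"
    unfolding g_def using pos
    by (auto intro!: derivative_eq_intros simp: powr_diff field_simps)
  moreover have "\<forall>w. \<bar>v - w\<bar> < \<bar>v\<bar> \<longrightarrow> g v \<le> g w"
  proof (intro allI impI)
    fix w assume "\<bar>v - w\<bar> < \<bar>v\<bar>"
    then have "sgn v * w = \<bar>w\<bar>"
      by (auto simp: sgn_if abs_if split: if_splits)
    then show "g v \<le> g w"
      using prox_minimizes[OF assms(1-3), of z w] abs_v by (simp add: g_def v[symmetric])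
  qed
  ultimately have "- (z - v) + lam * mu * (q * (sgn v * v) powr (q - 1) * sgn v) = 0"
    using \<open>v \<noteq> 0\<close> by (intro DERIV_local_min[of g _ v "\<bar>v\<bar>"]) auto
  then show ?thesis
    unfolding abs_v by (simp add: algebra_simps)
next
  case True
  define n where "n = eta lam q mu"
  have B: "0 < 2 * lam * mu * (1 - q)"
    using assms by simp
  then have n: "0 < n"
    by (auto simp: n_def eta_def)
  have v: "v = sgn z * n"
    using assms True by (auto simp: threshold_def n_def split: if_splits)
  have z0: "z \<noteq> 0" using v \<open>v \<noteq> 0\<close> by auto
  have z: "z = sgn z * ((2 - q) / (2 - 2 * q) * n)"
    using True by (simp add: tau_def n_def eta_def[symmetric] sgn_if abs_if split: if_splits)
  have sv: "sgn v = sgn z" "\<bar>v\<bar> = n"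
    using n z0 by (auto simp: v sgn_if)
  \<comment> \<open>The definition of \<open>eta\<close> solved for its base; multiplying by
    \<open>n powr (q - 1)\<close> evaluates the penalty derivative as a multiple of
    \<open>n\<close>, so that the remaining identity is rational in \<open>q\<close>.\<close>
  have "2 * lam * mu * (1 - q) = n powr (2 - q)"
    using B assms(4) by (simp add: n_def eta_def powr_powr less_imp_le)
  then have "2 * lam * mu * (1 - q) * n powr (q - 1) = n powr (2 - q) * n powr (q - 1)"
    by simp
  also have "\<dots> = n"
    using n by (simp flip: powr_add)
  finally have "lam * mu * n powr (q - 1) = n / (2 * (1 - q))"
    using assms by (simp add: field_simps)
  moreover have "lam * mu * q * sgn v * \<bar>v\<bar> powr (q - 1) = sgn z * (q * (lam * mu * n powr (q - 1)))"
    by (simp add: sv)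
  ultimately have "lam * mu * q * sgn v * \<bar>v\<bar> powr (q - 1) = sgn z * (q * (n / (2 * (1 - q))))"
    by simp
  then have "v - z + lam * mu * q * sgn v * \<bar>v\<bar> powr (q - 1)
    = sgn z * (n - (2 - q) / (2 - 2 * q) * n + q * (n / (2 * (1 - q))))"
    using z v by (metis (no_types, opaque_lifting) distrib_left right_diff_distrib)
  also have "n - (2 - q) / (2 - 2 * q) * n + q * (n / (2 * (1 - q))) = 0"
    using assms by (simp add: field_simps)
  finally show ?thesis by simp
qed

section \<open>Local lower bounds for the penalty\<close>

text \<open>The second derivative of \<open>t powr q\<close> is
  \<open>- q (1 - q) t powr (q - 2)\<close>. The strict inequality at \<open>b\<close> persists
  nearby by continuity, so the Lagrange remainder of second order is at least
  \<open>- c / 2 * k^2\<close>.\<close>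

lemma powr_ge_quadratic:
  fixes b q c :: real
  assumes "0 < b" and c: "q * (1 - q) * b powr (q - 2) < c"
  shows "\<exists>d>0. \<forall>k. \<bar>k\<bar> < d \<longrightarrow>
    b powr q + q * b powr (q - 1) * k - c / 2 * k\<^sup>2 \<le> (b + k) powr q"
proof -
  have "isCont (\<lambda>t. q * (1 - q) * t powr (q - 2)) b"
    using \<open>0 < b\<close> by (auto intro!: continuous_intros)
  then have "\<forall>\<^sub>F t in at b. q * (1 - q) * t powr (q - 2) < c"
    unfolding isCont_def using c by (rule order_tendstoD(2))
  then obtain d where d: "0 < d"
    "\<And>t. t \<noteq> b \<Longrightarrow> \<bar>t - b\<bar> < d \<Longrightarrow> q * (1 - q) * t powr (q - 2) < c"
    by (auto simp: eventually_at dist_real_def)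
  \<comment> \<open>The bound \<open>d\<close> keeps the intermediate point in the continuity
    neighbourhood; \<open>b / 2\<close> keeps the expansion inside an interval of positive
    reals.\<close>
  define r where "r = min d (b / 2)"
  have "b powr q + q * b powr (q - 1) * k - c / 2 * k\<^sup>2 \<le> (b + k) powr q" if k: "\<bar>k\<bar> < r" for k
  proof (cases "k = 0")
    case False
    \<comment> \<open>The derivatives of orders 0, 1 and 2, in the indexed form that
      \<open>Taylor\<close> expects.\<close>
    define D where "D = (\<lambda>n t. if n = 0 then t powr q
      else if n = Suc 0 then q * t powr (q - 1) else q * ((q - 1) * t powr (q - 2)) :: real)"
    have "DERIV (D n) t :> D (Suc n) t" if "n < 2" "b / 2 \<le> t" for n t
    proof -
      have "0 < t" using that \<open>0 < b\<close> by simp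
      have "n = 0 \<or> n = 1" using that by auto
      then show ?thesis
        using has_real_derivative_powr[of t q] \<open>0 < t\<close>
          DERIV_cmult[OF has_real_derivative_powr[of t "q - 1"], of q]
        by (auto simp: D_def)
    qed
    then have "\<exists>t. (if b + k < b then b + k < t \<and> t < b else b < t \<and> t < b + k) \<and>
      (b + k) powr q = (\<Sum>n<2. D n b / fact n * (b + k - b) ^ n) + D 2 t / fact 2 * (b + k - b) ^ 2"
      using k False \<open>0 < b\<close>
      by (intro Taylor[where a = "b / 2" and b = "3 * b / 2"]) (auto simp: D_def r_def)
    then obtain t where t: "if b + k < b then b + k < t \<and> t < b else b < t \<and> t < b + k"
      and eq: "(b + k) powr q = b powr q + q * b powr (q - 1) * k + q * ((q - 1) * t powr (q - 2)) / 2 * k\<^sup>2"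
      by (auto simp: D_def numeral_2_eq_2 simp del: One_nat_def)
    have "q * (1 - q) * t powr (q - 2) < c"
      using t k by (intro d(2)) (auto simp: r_def split: if_splits)
    then have "- c / 2 \<le> q * ((q - 1) * t powr (q - 2)) / 2"
      by (simp add: algebra_simps)
    then have "- c / 2 * k\<^sup>2 \<le> q * ((q - 1) * t powr (q - 2)) / 2 * k\<^sup>2"
      by (rule mult_right_mono) simp
    then show ?thesis
      unfolding eq by simp
  qed simp
  then show ?thesis
    using d(1) \<open>0 < b\<close> by (intro exI[of _ r]) (auto simp: r_def)
qed

text \<open>Reflection to the positive case with increment \<open>sgn a * h\<close>; for
  \<open>|h| < |a|\<close> the perturbed point keeps the sign of \<open>a\<close>.\<close>

lemma abs_powr_ge_quadratic:
  fixes a q c :: real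
  assumes "a \<noteq> 0" and "q * (1 - q) * \<bar>a\<bar> powr (q - 2) < c"
  shows "\<exists>d>0. \<forall>h. \<bar>h\<bar> < d \<longrightarrow>
    \<bar>a\<bar> powr q + q * sgn a * \<bar>a\<bar> powr (q - 1) * h - c / 2 * h\<^sup>2 \<le> \<bar>a + h\<bar> powr q"
proof -
  obtain d where d: "0 < d" "\<And>k. \<bar>k\<bar> < d \<Longrightarrow>
    \<bar>a\<bar> powr q + q * \<bar>a\<bar> powr (q - 1) * k - c / 2 * k\<^sup>2 \<le> (\<bar>a\<bar> + k) powr q"
    using powr_ge_quadratic[of "\<bar>a\<bar>" q c] assms by auto
  have "\<bar>a\<bar> powr q + q * sgn a * \<bar>a\<bar> powr (q - 1) * h - c / 2 * h\<^sup>2 \<le> \<bar>a + h\<bar> powr q"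
    if "\<bar>h\<bar> < min d \<bar>a\<bar>" for h
  proof -
    have "\<bar>sgn a * h\<bar> = \<bar>h\<bar>" "(sgn a * h)\<^sup>2 = h\<^sup>2" "\<bar>a\<bar> + sgn a * h = \<bar>a + h\<bar>"
      using that assms(1) by (auto simp: sgn_if abs_if split: if_splits)
    with d(2)[of "sgn a * h"] that show ?thesis
      by (simp add: mult_ac)
  qed
  then show ?thesis
    using d(1) assms(1) by (intro exI[of _ "min d \<bar>a\<bar>"]) auto
qed

text \<open>Factor \<open>|h|\<close> as \<open>|h| powr (1 - q) * |h| powr q\<close>: the first
  factor tends to 0 with \<open>h\<close> because \<open>q < 1\<close>. This makes zero coordinates
  stable against any linear term.\<close>

lemma linear_le_abs_powr:
  fixes C q lam :: real
  assumes "0 < lam" "q < 1"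
  shows "\<exists>d>0. \<forall>h. \<bar>h\<bar> < d \<longrightarrow> C * \<bar>h\<bar> \<le> lam * \<bar>h\<bar> powr q"
proof -
  \<comment> \<open>The added 1 avoids division by zero. The radius
    \<open>p powr (1 / (1 - q))\<close> below is where \<open>|h| powr (1 - q)\<close> reaches
    \<open>p\<close>.\<close>
  define p where "p = lam / (\<bar>C\<bar> + 1)"
  have p: "0 < p" using assms by (simp add: p_def add_nonneg_pos)
  have "C * \<bar>h\<bar> \<le> lam * \<bar>h\<bar> powr q" if h: "\<bar>h\<bar> < p powr (1 / (1 - q))" for h
  proof (cases "h = 0")
    case False
    have "\<bar>h\<bar> powr (1 - q) \<le> (p powr (1 / (1 - q))) powr (1 - q)"
      using h assms by (intro powr_mono2) auto
    also have "\<dots> = p"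
      using assms p by (simp add: powr_powr)
    finally have "(\<bar>C\<bar> + 1) * \<bar>h\<bar> powr (1 - q) \<le> lam"
      by (simp add: p_def field_simps)
    then have "(\<bar>C\<bar> + 1) * \<bar>h\<bar> powr (1 - q) * \<bar>h\<bar> powr q \<le> lam * \<bar>h\<bar> powr q"
      by (rule mult_right_mono) simp
    moreover have "\<bar>h\<bar> powr (1 - q) * \<bar>h\<bar> powr q = \<bar>h\<bar>"
      using False by (simp flip: powr_add)
    ultimately have "(\<bar>C\<bar> + 1) * \<bar>h\<bar> \<le> lam * \<bar>h\<bar> powr q"
      by (simp add: mult.assoc)
    moreover have "C * \<bar>h\<bar> \<le> (\<bar>C\<bar> + 1) * \<bar>h\<bar>"
      by (intro mult_right_mono) auto
    ultimately show ?thesis by linarith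
  qed simp
  then show ?thesis
    using p by (intro exI[of _ "p powr (1 / (1 - q))"]) auto
qed

section \<open>The Gram matrix of the columns in the support\<close>

text \<open>\<open>submatrix\<close> numbers the selected columns through \<open>pick\<close>, the
  increasing enumeration of \<open>I\<close>; its inverse counts the smaller elements. The bijection
  turns sums over positions into sums over \<open>I\<close>.\<close>

lemma bij_betw_pick:
  assumes "finite I"
  shows "bij_betw (pick I) {..<card I} I"
proof (rule bij_betw_byWitness[where f' = "\<lambda>i. card {a \<in> I. a < i}"])
  show "(\<lambda>i. card {a \<in> I. a < i}) ` I \<subseteq> {..<card I}"
    using assms by (auto intro!: psubset_card_mono)
  show "\<forall>j\<in>{..<card I}. card {a \<in> I. a < pick I j} = j"
    using card_pick by blast
  show "\<forall>i\<in>I. pick I (card {a \<in> I. a < i}) = i"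
    using pick_card_in_set by blast
  show "pick I ` {..<card I} \<subseteq> I"
    using pick_in_set by blast
qed

text \<open>A vector \<open>h\<close> vanishing off \<open>I\<close> compresses to \<open>w\<close>
  with \<open>A_I w = A h\<close> and the same square norm, so the Rayleigh bound for the Gram
  matrix of \<open>A_I\<close> applies to \<open>w\<close>.\<close>

lemma sigma_min_le_norm_square:
  fixes A :: "real mat"
  assumes A: "A \<in> carrier_mat m N" and I: "I \<subseteq> {..<N}" "I \<noteq> {}"
    and h: "h \<in> carrier_vec N" and supp: "\<And>i. i < N \<Longrightarrow> i \<notin> I \<Longrightarrow> h $ i = 0"
  shows "sigma_min (transpose_mat (column_submatrix A I) * column_submatrix A I) * (\<Sum>i\<in>I. (h $ i)\<^sup>2)
    \<le> (A *\<^sub>v h) \<bullet> (A *\<^sub>v h)"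
proof -
  define k where "k = card I"
  define G where "G = column_submatrix A I"
  define w where "w = vec k (\<lambda>j. h $ pick I j)"
  have fin: "finite I" using I finite_subset by blast
  have k: "0 < k" using I fin by (simp add: k_def card_gt_0_iff)
  have bij: "bij_betw (pick I) {0..<k} I"
    using bij_betw_pick[OF fin] by (simp add: k_def atLeast0LessThan)
  have "{j. j < N \<and> j \<in> I} = I" using I by auto
  then have G: "G \<in> carrier_mat m k"
    and G_index: "\<And>r j. r < m \<Longrightarrow> j < k \<Longrightarrow> G $$ (r, j) = A $$ (r, pick I j)"
    using A by (auto simp: G_def column_submatrix_def submatrix_def k_def pick_UNIV)
  have w: "w \<in> carrier_vec k" by (simp add: w_def)
  have Gw: "G *\<^sub>v w = A *\<^sub>v h"
  proof (rule eq_vecI)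
    fix r assume "r < dim_vec (A *\<^sub>v h)"
    then have r: "r < m" using A by simp
    have "(G *\<^sub>v w) $ r = (\<Sum>j = 0..<k. A $$ (r, pick I j) * h $ pick I j)"
      using r G by (simp add: scalar_prod_def w_def G_index)
    also have "\<dots> = (\<Sum>i\<in>I. A $$ (r, i) * h $ i)"
      by (rule sum.reindex_bij_betw[OF bij])
    also have "\<dots> = (\<Sum>i = 0..<N. A $$ (r, i) * h $ i)"
      using I supp by (intro sum.mono_neutral_left) auto
    also have "\<dots> = (A *\<^sub>v h) $ r"
      using r A h by (simp add: scalar_prod_def)
    finally show "(G *\<^sub>v w) $ r = (A *\<^sub>v h) $ r" .
  qed (use A G in auto)
  have ww: "w \<bullet> w = (\<Sum>i\<in>I. (h $ i)\<^sup>2)"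
    using sum.reindex_bij_betw[OF bij, of "\<lambda>i. (h $ i)\<^sup>2"]
    by (simp add: scalar_prod_def w_def power2_eq_square)
  have "Min (spectrum (transpose_mat G * G)) * (w \<bullet> w) \<le> w \<bullet> ((transpose_mat G * G) *\<^sub>v w)"
    using G k w by (intro Min_spectrum_le_Rayleigh) (auto simp: transpose_mult[of _ k m])
  also have "(transpose_mat G * G) *\<^sub>v w = transpose_mat G *\<^sub>v (G *\<^sub>v w)"
    using G w by (intro assoc_mult_mat_vec[of _ k m]) auto
  also have "w \<bullet> \<dots> = \<dots> \<bullet> w"
    using G w by (intro comm_scalar_prod[of _ k]) auto
  also have "\<dots> = (G *\<^sub>v w) \<bullet> (G *\<^sub>v w)"
    using G w by (intro transpose_vec_mult_scalar) auto
  finally show ?thesis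
    by (simp add: sigma_min_def G_def[symmetric] ww Gw)
qed

section \<open>Stationarity of the limit of the iteration\<close>

lemma ccd_sequence_carrier:
  assumes "ccd_sequence A y lam q mu x"
  shows "x n \<in> carrier_vec (dim_col A)"
proof (induction n)
  case (Suc n)
  have "x (Suc n) = ccd_step A y lam q mu (n mod dim_col A) (x n)"
    using assms by (simp add: ccd_sequence_def)
  moreover have "dim_vec (ccd_step A y lam q mu (n mod dim_col A) (x n)) = dim_vec (x n)"
    by (simp add: ccd_step_def Let_def)
  ultimately show ?case
    using Suc by (metis carrier_vecD carrier_vecI)
qed (use assms in \<open>simp add: ccd_sequence_def\<close>)

lemma vec_converges_to_index:
  assumes conv: "vec_converges_to x a" and "a \<in> carrier_vec N" "\<And>n. x n \<in> carrier_vec N" "j < N"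
  shows "(\<lambda>n. x n $ j) \<longlonglongrightarrow> a $ j"
proof (rule LIM_zero_cancel, rule tendsto_0_le[where K = 1])
  show "(\<lambda>n. l2_norm (x n - a)) \<longlonglongrightarrow> 0"
    using conv by (simp add: vec_converges_to_def)
  have "norm (x n $ j - a $ j) \<le> norm (l2_norm (x n - a)) * 1" for n
    using abs_index_le_l2_norm[of j "x n - a"] assms by auto
  then show "\<forall>\<^sub>F n in sequentially. norm (x n $ j - a $ j) \<le> norm (l2_norm (x n - a)) * 1"
    by simp
qed

text \<open>The stationarity equation of each update of coordinate \<open>i\<close> is passed to the
  limit along the steps that perform this update, and the factor \<open>mu > 0\<close> is divided
  out.\<close>

lemma ccd_limit_stationary:
  assumes A: "A \<in> carrier_mat m N" and y: "y \<in> carrier_vec m"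
    and par: "0 < lam" "0 < mu" "0 < q" "q < 1"
    and ccd: "ccd_sequence A y lam q mu x"
    and xs: "xs \<in> carrier_vec N" and conv: "vec_converges_to x xs"
    and i: "i < N" "xs $ i \<noteq> 0"
  shows "col A i \<bullet> (A *\<^sub>v xs - y) + lam * q * sgn (xs $ i) * \<bar>xs $ i\<bar> powr (q - 1) = 0"
proof -
  define g where "g = (\<lambda>w. col A i \<bullet> (A *\<^sub>v w - y))"
  have g: "g w = (\<Sum>r = 0..<m. A $$ (r, i) * ((\<Sum>j = 0..<N. A $$ (r, j) * w $ j) - y $ r))"
    if "w \<in> carrier_vec N" for w
    using A y i(1) that by (simp add: g_def scalar_prod_def)
  have x: "x n \<in> carrier_vec N" for n
    using ccd_sequence_carrier[OF ccd] A by auto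
  have lim: "(\<lambda>n. x n $ j) \<longlonglongrightarrow> xs $ j" if "j < N" for j
    using vec_converges_to_index[OF conv xs x that] .
  have lim_g: "(\<lambda>n. g (x n)) \<longlonglongrightarrow> g xs"
    unfolding g[OF x] g[OF xs] by (intro tendsto_intros lim) auto
  \<comment> \<open>Exactly the steps that update coordinate \<open>i\<close>; the new value is
    therefore read at index \<open>Suc (s k)\<close>, while \<open>z\<close> uses the old
    iterate.\<close>
  define s where "s = (\<lambda>k. k * N + i)"
  have s: "filterlim s sequentially sequentially"
    using i(1) by (intro filterlim_subseq strict_monoI) (simp add: s_def)
  define v where "v = (\<lambda>k. x (Suc (s k)) $ i)"
  define z where "z = (\<lambda>k. x (s k) $ i - mu * g (x (s k)))"
  have v_eq: "v k = threshold lam q mu (z k) (x (s k) $ i)" for k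
  proof -
    have "s k mod dim_col A = i"
      using i(1) A by (simp add: s_def)
    then have "x (Suc (s k)) = ccd_step A y lam q mu i (x (s k))"
      using ccd by (simp add: ccd_sequence_def)
    then show ?thesis
      using i(1) x[of "s k"] by (simp add: v_def z_def g_def ccd_step_def Let_def)
  qed
  have lim_v: "v \<longlonglongrightarrow> xs $ i"
    unfolding v_def by (rule filterlim_compose[OF filterlim_compose[OF lim[OF i(1)] filterlim_Suc] s])
  have lim_z: "z \<longlonglongrightarrow> xs $ i - mu * g xs"
    unfolding z_def
    by (rule tendsto_diff[OF filterlim_compose[OF lim[OF i(1)] s]
          tendsto_mult_left[OF filterlim_compose[OF lim_g s]]])
  have "(\<lambda>k. v k - z k + lam * mu * q * sgn (v k) * \<bar>v k\<bar> powr (q - 1)) \<longlonglongrightarrow>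
    xs $ i - (xs $ i - mu * g xs) + lam * mu * q * sgn (xs $ i) * \<bar>xs $ i\<bar> powr (q - 1)"
    \<comment> \<open>A nonzero limit is what makes \<open>sgn\<close> and the power with negative
      exponent continuous there.\<close>
    using i(2) by (intro tendsto_intros lim_v lim_z) auto
  moreover have "\<forall>\<^sub>F k in sequentially. v k \<noteq> 0"
    by (rule tendsto_imp_eventually_ne[OF lim_v i(2)])
  then have "\<forall>\<^sub>F k in sequentially. v k - z k + lam * mu * q * sgn (v k) * \<bar>v k\<bar> powr (q - 1) = 0"
    by eventually_elim (rule threshold_stationary[OF par v_eq[symmetric]])
  then have "(\<lambda>k. v k - z k + lam * mu * q * sgn (v k) * \<bar>v k\<bar> powr (q - 1)) \<longlonglongrightarrow> 0"
    by (rule tendsto_eventually)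
  ultimately have "xs $ i - (xs $ i - mu * g xs) + lam * mu * q * sgn (xs $ i) * \<bar>xs $ i\<bar> powr (q - 1) = 0"
    by (rule LIMSEQ_unique)
  then have "mu * (g xs + lam * q * sgn (xs $ i) * \<bar>xs $ i\<bar> powr (q - 1)) = 0"
    by (simp add: algebra_simps)
  then show ?thesis
    using par by (simp add: g_def)
qed

section \<open>Local minimality from stationarity and curvature\<close>

lemma mult_mat_vec_scalar_prod:
  fixes A :: "real mat"
  assumes A: "A \<in> carrier_mat m N" and h: "h \<in> carrier_vec N" and w: "w \<in> carrier_vec m"
  shows "(A *\<^sub>v h) \<bullet> w = (\<Sum>i = 0..<N. h $ i * (col A i \<bullet> w))"
proof -
  have "(A *\<^sub>v h) \<bullet> w = w \<bullet> (A *\<^sub>v h)"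
    by (rule comm_scalar_prod[OF mult_mat_vec_carrier[OF A h] w])
  also have "\<dots> = (transpose_mat A *\<^sub>v w) \<bullet> h"
    by (rule transpose_vec_mult_scalar[OF A h w, symmetric])
  also have "\<dots> = (\<Sum>i = 0..<N. h $ i * (col A i \<bullet> w))"
    unfolding scalar_prod_def[of _ h] using A h by (intro sum.cong) auto
  finally show ?thesis .
qed

text \<open>
  With \<open>h = h\<^sub>I + h'\<close>, the increment of the smooth part is at least
  \<open>A h \<bullet> r + \<bar>A h\<^sub>I\<bar>\<^sup>2 / 2 + A h' \<bullet> A h\<^sub>I\<close>. On \<open>I\<close> the first-order terms cancel by stationarity and the
  curvature bound absorbs the concavity of \<open>\<bar>t\<bar> powr q\<close>; off \<open>I\<close> everything is linear in \<open>h'\<close> and is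
  dominated by \<open>lam * \<bar>h\<^sub>i\<bar> powr q\<close>.
\<close>

lemma lq_local_minimizer:
  fixes A :: "real mat"
  assumes A: "A \<in> carrier_mat m N" and y: "y \<in> carrier_vec m"
    and par: "0 < lam" "0 < q" "q < 1"
    and xs: "xs \<in> carrier_vec N"
    and stat: "\<And>i. i \<in> supp xs \<Longrightarrow>
      col A i \<bullet> (A *\<^sub>v xs - y) + lam * q * sgn (xs $ i) * \<bar>xs $ i\<bar> powr (q - 1) = 0"
    and curv: "\<And>h. h \<in> carrier_vec N \<Longrightarrow> (\<And>i. i < N \<Longrightarrow> i \<notin> supp xs \<Longrightarrow> h $ i = 0) \<Longrightarrow>
      sg * (\<Sum>i\<in>supp xs. (h $ i)\<^sup>2) \<le> (A *\<^sub>v h) \<bullet> (A *\<^sub>v h)"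
    and sg: "\<And>i. i \<in> supp xs \<Longrightarrow> lam * q * (1 - q) * \<bar>xs $ i\<bar> powr (q - 2) < sg"
  shows "local_minimizer N (lq_objective A y lam q) xs"
proof -
  define I where "I = supp xs"
  define J where "J = {0..<N} - I"
  define r where "r = A *\<^sub>v xs - y"
  have I: "I \<subseteq> {0..<N}" and fin: "finite I" "finite J"
    using xs finite_subset[of I "{0..<N}"] by (auto simp: I_def J_def supp_def)
  have r: "r \<in> carrier_vec m" unfolding r_def by (intro minus_carrier_vec mult_mat_vec_carrier[OF A xs] y)
  have split: "(\<Sum>i = 0..<N. f i) = (\<Sum>i\<in>I. f i) + (\<Sum>i\<in>J. f i)" for f :: "nat \<Rightarrow> real"
    using sum.subset_diff[OF I, of f] by (simp add: J_def)
  obtain D where D: "0 < D" "\<And>v. v \<in> carrier_vec N \<Longrightarrow> (A *\<^sub>v v) \<bullet> (A *\<^sub>v v) \<le> D * (v \<bullet> v)"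
    using mult_mat_vec_bounded[OF A] by blast
  define T where "T = transpose_mat A"
  have T: "T \<in> carrier_mat N m" using A by (simp add: T_def)
  obtain E where E: "0 < E" "\<And>v. v \<in> carrier_vec m \<Longrightarrow> (T *\<^sub>v v) \<bullet> (T *\<^sub>v v) \<le> E * (v \<bullet> v)"
    using mult_mat_vec_bounded[OF T] by blast
  \<comment> \<open>A uniform bound for \<open>|A_i . (r + a)|\<close> with \<open>a = A hI\<close>:
    the first summand handles the residual \<open>r\<close>, the second \<open>a\<close>, since
    \<open>hI . hI <= N\<close> once all entries are at most 1 in modulus.\<close>
  define C where "C = l2_norm (T *\<^sub>v r) + sqrt (E * (D * real N))"
  \<comment> \<open>The curvature \<open>sg\<close> is divided by \<open>lam\<close> because the
    penalty enters the objective with weight \<open>lam\<close>.\<close>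
  have "\<exists>d>0. \<forall>t. \<bar>t\<bar> < d \<longrightarrow> \<bar>xs $ i\<bar> powr q + q * sgn (xs $ i) * \<bar>xs $ i\<bar> powr (q - 1) * t
    - (sg / lam) / 2 * t\<^sup>2 \<le> \<bar>xs $ i + t\<bar> powr q" if "i \<in> I" for i
    using that sg[of i] par by (intro abs_powr_ge_quadratic) (auto simp: I_def supp_def field_simps)
  then obtain d where d: "\<And>i. i \<in> I \<Longrightarrow> 0 < d i"
    and quad: "\<And>i t. i \<in> I \<Longrightarrow> \<bar>t\<bar> < d i \<Longrightarrow>
      \<bar>xs $ i\<bar> powr q + q * sgn (xs $ i) * \<bar>xs $ i\<bar> powr (q - 1) * t - (sg / lam) / 2 * t\<^sup>2
      \<le> \<bar>xs $ i + t\<bar> powr q"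
    by metis
  obtain d' where d': "0 < d'" "\<And>t. \<bar>t\<bar> < d' \<Longrightarrow> C * \<bar>t\<bar> \<le> lam * \<bar>t\<bar> powr q"
    using linear_le_abs_powr[of lam q C] par by auto
  \<comment> \<open>The entry 1 yields the bound on \<open>hI\<close> used for \<open>C\<close>, and
    keeps the set nonempty together with \<open>d'\<close> when the support is empty.\<close>
  define eps where "eps = Min (insert 1 (insert d' (d ` I)))"
  have "0 < eps"
    using d d' fin by (auto simp: eps_def)
  moreover have "eps \<le> t" if "t \<in> insert 1 (insert d' (d ` I))" for t
    unfolding eps_def using fin that by (intro Min_le) auto
  ultimately have eps: "0 < eps" "eps \<le> 1" "eps \<le> d'" "\<And>i. i \<in> I \<Longrightarrow> eps \<le> d i"
    by auto
  have "lq_objective A y lam q xs \<le> lq_objective A y lam q u"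
    if u: "u \<in> carrier_vec N" and near: "l2_norm (u - xs) < eps" for u
  proof -
    define h where "h = u - xs"
    define hI where "hI = vec N (\<lambda>i. if i \<in> I then h $ i else 0)"
    define hJ where "hJ = vec N (\<lambda>i. if i \<in> I then 0 else h $ i)"
    have carr: "h \<in> carrier_vec N" "hI \<in> carrier_vec N" "hJ \<in> carrier_vec N"
      using u xs by (auto simp: h_def hI_def hJ_def)
    have small: "\<bar>h $ i\<bar> < eps" if "i < N" for i
      using abs_index_le_l2_norm[of i h] that near carr(1) unfolding h_def[symmetric] by auto
    define a where "a = A *\<^sub>v hI"
    define b where "b = A *\<^sub>v hJ"
    have ab: "a \<in> carrier_vec m" "b \<in> carrier_vec m"
      using A carr by (auto simp: a_def b_def intro!: mult_mat_vec_carrier)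
    have "u = xs + (hI + hJ)"
      using u xs by (intro eq_vecI) (auto simp: h_def hI_def hJ_def)
    then have "A *\<^sub>v u = A *\<^sub>v xs + (a + b)"
      using A xs carr by (simp add: mult_add_distrib_mat_vec[OF A] a_def b_def)
    then have "A *\<^sub>v u - y = r + (a + b)"
      using A y xs ab by (intro eq_vecI) (auto simp: r_def)
    \<comment> \<open>The terms in \<open>b\<close> are grouped as \<open>b . (r + a)\<close>, which
      is linear in the part of \<open>h\<close> off the support; the square \<open>b . b\<close> is
      later discarded by sign.\<close>
    then have res: "(l2_norm (A *\<^sub>v u - y))\<^sup>2 = r \<bullet> r + 2 * (a \<bullet> r) + 2 * (b \<bullet> (r + a)) + a \<bullet> a + b \<bullet> b"
      using r ab comm_scalar_prod[OF r ab(1)] comm_scalar_prod[OF r ab(2)] comm_scalar_prod[OF ab]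
      by (simp add: l2_norm_power2 add_scalar_prod_distrib[of _ m] scalar_prod_add_distrib[of _ m])
    have ar: "a \<bullet> r = (\<Sum>i\<in>I. h $ i * (col A i \<bullet> r))"
    proof -
      have "a \<bullet> r = (\<Sum>i = 0..<N. hI $ i * (col A i \<bullet> r))"
        unfolding a_def by (rule mult_mat_vec_scalar_prod[OF A carr(2) r])
      also have "\<dots> = (\<Sum>i\<in>I. hI $ i * (col A i \<bullet> r))"
        using I by (intro sum.mono_neutral_right) (auto simp: hI_def)
      also have "\<dots> = (\<Sum>i\<in>I. h $ i * (col A i \<bullet> r))"
        using I by (intro sum.cong) (auto simp: hI_def)
      finally show ?thesis .
    qed
    have "hI \<bullet> hI \<le> real N"
    proof -
      have "hI \<bullet> hI = (\<Sum>i = 0..<N. (hI $ i)\<^sup>2)"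
        by (simp add: scalar_prod_def hI_def power2_eq_square)
      also have "\<dots> \<le> (\<Sum>i = 0..<N. 1)"
      proof (rule sum_mono)
        fix i assume "i \<in> {0..<N}"
        then have "\<bar>hI $ i\<bar> \<le> 1"
          using small[of i] eps(2) by (auto simp: hI_def)
        then show "(hI $ i)\<^sup>2 \<le> 1" by (simp add: abs_square_le_1)
      qed
      finally show ?thesis by simp
    qed
    then have "D * (hI \<bullet> hI) \<le> D * real N"
      using D(1) by simp
    with D(2)[OF carr(2)] have "a \<bullet> a \<le> D * real N"
      unfolding a_def by (rule order_trans)
    then have "E * (a \<bullet> a) \<le> E * (D * real N)"
      using E(1) by simp
    with E(2)[OF ab(1)] have "(T *\<^sub>v a) \<bullet> (T *\<^sub>v a) \<le> E * (D * real N)"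
      by (rule order_trans)
    then have Ta: "l2_norm (T *\<^sub>v a) \<le> sqrt (E * (D * real N))"
      by (simp add: l2_norm_def)
    have br: "- (\<Sum>i\<in>J. C * \<bar>h $ i\<bar>) \<le> b \<bullet> (r + a)"
    proof -
      have col_le: "\<bar>col A i \<bullet> (r + a)\<bar> \<le> C" if "i < N" for i
      proof -
        have "col A i \<bullet> (r + a) = (T *\<^sub>v r) $ i + (T *\<^sub>v a) $ i"
          using A r ab that by (simp add: T_def scalar_prod_add_distrib[of _ m])
        moreover have "\<bar>(T *\<^sub>v r) $ i\<bar> \<le> l2_norm (T *\<^sub>v r)" "\<bar>(T *\<^sub>v a) $ i\<bar> \<le> l2_norm (T *\<^sub>v a)"
          using that T by (intro abs_index_le_l2_norm, simp)+
        ultimately show ?thesis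
          using Ta by (simp add: C_def)
      qed
      have "b \<bullet> (r + a) = (\<Sum>i = 0..<N. hJ $ i * (col A i \<bullet> (r + a)))"
        unfolding b_def using r ab by (intro mult_mat_vec_scalar_prod[OF A carr(3)]) auto
      also have "\<dots> = (\<Sum>i\<in>J. hJ $ i * (col A i \<bullet> (r + a)))"
        by (intro sum.mono_neutral_right) (auto simp: hJ_def J_def)
      also have "\<dots> = (\<Sum>i\<in>J. h $ i * (col A i \<bullet> (r + a)))"
        by (intro sum.cong) (auto simp: hJ_def J_def)
      also have "\<dots> \<ge> (\<Sum>i\<in>J. - (C * \<bar>h $ i\<bar>))"
      proof (rule sum_mono)
        fix i assume "i \<in> J"
        then have "\<bar>h $ i * (col A i \<bullet> (r + a))\<bar> \<le> C * \<bar>h $ i\<bar>"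
          using mult_right_mono[OF col_le[of i], of "\<bar>h $ i\<bar>"]
          by (simp add: J_def abs_mult mult.commute)
        then show "- (C * \<bar>h $ i\<bar>) \<le> h $ i * (col A i \<bullet> (r + a))" by linarith
      qed
      finally show ?thesis by (simp add: sum_negf)
    qed
    have aa: "sg * (\<Sum>i\<in>I. (h $ i)\<^sup>2) \<le> a \<bullet> a"
    proof -
      have "(\<Sum>i\<in>I. (h $ i)\<^sup>2) = (\<Sum>i\<in>supp xs. (hI $ i)\<^sup>2)"
        using I by (intro sum.cong) (auto simp: hI_def I_def)
      then show ?thesis
        using curv[OF carr(2)] by (simp add: a_def hI_def I_def)
    qed
    have ui: "u $ i = xs $ i + h $ i" if "i < N" for i
      using that u xs by (simp add: h_def)
    have onI: "lam * \<bar>xs $ i\<bar> powr q - h $ i * (col A i \<bullet> r) - sg / 2 * (h $ i)\<^sup>2 \<le> lam * \<bar>u $ i\<bar> powr q"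
      if i: "i \<in> I" for i
    proof -
      have "i < N" using i I by auto
      have "col A i \<bullet> r = - (lam * q * sgn (xs $ i) * \<bar>xs $ i\<bar> powr (q - 1))"
        using stat[of i] i by (simp add: r_def I_def)
      then have "lam * \<bar>xs $ i\<bar> powr q - h $ i * (col A i \<bullet> r) - sg / 2 * (h $ i)\<^sup>2
        = lam * (\<bar>xs $ i\<bar> powr q + q * sgn (xs $ i) * \<bar>xs $ i\<bar> powr (q - 1) * h $ i
          - (sg / lam) / 2 * (h $ i)\<^sup>2)"
        using par by (simp add: field_simps)
      also have "\<dots> \<le> lam * \<bar>u $ i\<bar> powr q"
        using quad[OF i, of "h $ i"] small[OF \<open>i < N\<close>] eps(4)[OF i] par ui[OF \<open>i < N\<close>] by simp
      finally show ?thesis .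
    qed
    have offI: "C * \<bar>h $ i\<bar> \<le> lam * \<bar>u $ i\<bar> powr q" and xs0: "xs $ i = 0" if "i \<in> J" for i
    proof -
      have i: "i < N" and 0: "xs $ i = 0"
        using that xs by (auto simp: J_def I_def supp_def)
      show "C * \<bar>h $ i\<bar> \<le> lam * \<bar>u $ i\<bar> powr q"
        using d'(2)[of "h $ i"] small[OF i] eps(3) ui[OF i] 0 by simp
      show "xs $ i = 0" by (rule 0)
    qed
    have "(\<Sum>i\<in>I. lam * \<bar>xs $ i\<bar> powr q) - a \<bullet> r - sg / 2 * (\<Sum>i\<in>I. (h $ i)\<^sup>2)
      \<le> (\<Sum>i\<in>I. lam * \<bar>u $ i\<bar> powr q)"
      using sum_mono[OF onI] by (simp add: ar sum_subtractf sum_distrib_left)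
    moreover have "(\<Sum>i\<in>J. C * \<bar>h $ i\<bar>) \<le> (\<Sum>i\<in>J. lam * \<bar>u $ i\<bar> powr q)"
      by (intro sum_mono offI)
    moreover have "(\<Sum>i\<in>J. lam * \<bar>xs $ i\<bar> powr q) = 0"
      using xs0 by simp
    ultimately have "(\<Sum>i = 0..<N. lam * \<bar>xs $ i\<bar> powr q) - a \<bullet> r - sg / 2 * (\<Sum>i\<in>I. (h $ i)\<^sup>2)
      - b \<bullet> (r + a) \<le> (\<Sum>i = 0..<N. lam * \<bar>u $ i\<bar> powr q)"
      using br by (simp add: split)
    \<comment> \<open>Half of \<open>aa\<close> pays for the loss \<open>sg / 2\<close> times the
      sum of squares, and the terms \<open>a . r\<close> cancel.\<close>
    then have "(r \<bullet> r) / 2 + (\<Sum>i = 0..<N. lam * \<bar>xs $ i\<bar> powr q)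
      \<le> (l2_norm (A *\<^sub>v u - y))\<^sup>2 / 2 + (\<Sum>i = 0..<N. lam * \<bar>u $ i\<bar> powr q)"
      using aa scalar_prod_self_nonneg[of b] by (simp add: res add_divide_distrib)
    then show ?thesis
      using u xs by (simp add: lq_objective_def l2_norm_power2[of r] r_def[symmetric]
        sum_distrib_left atLeast0LessThan)
  qed
  then show ?thesis
    using xs eps(1) by (auto simp: local_minimizer_def)
qed

theorem theorem6:
  fixes m N K :: nat
    and A :: "real mat"
    and y xstar :: "real vec"
    and lam q mu e :: real
    and x :: "nat \<Rightarrow> real vec"
    and I :: "nat set"
  assumes "m > 0" and "N > 0"
    and "A \<in> carrier_mat m N" and "y \<in> carrier_vec m"
    and "lam > 0" and "0 < q" and "q < 1"
    and "ccd_sequence A y lam q mu x"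
    and "0 < mu"
    and "L_max A \<noteq> 0 \<longrightarrow> mu < inverse (L_max A)"
    and "ereal (lq_objective A y lam q (x 0)) < \<infinity>"
    and "xstar \<in> carrier_vec N" and "vec_converges_to x xstar"
    and "I = supp xstar" and "K = card I"
    and "I \<noteq> {} \<longrightarrow> e = Min ((\<lambda>i. \<bar>xstar $ i\<bar>) ` I)"
    and "I \<noteq> {} \<longrightarrow>
           sigma_min (transpose_mat (column_submatrix A I) * column_submatrix A I) > 0"
    and "I \<noteq> {} \<longrightarrow>
           lam < sigma_min (transpose_mat (column_submatrix A I) * column_submatrix A I)
                 * \<bar>e\<bar> powr (2 - q) / (q * (1 - q))"
  shows "local_minimizer N (lq_objective A y lam q) xstar"
proof -
  define sg where "sg = sigma_min (transpose_mat (column_submatrix A I) * column_submatrix A I)"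
  have I: "I \<subseteq> {..<N}" and fin: "finite I"
    using assms(12,14) finite_subset[of I "{..<N}"] by (auto simp: supp_def)
  show ?thesis
  proof (rule lq_local_minimizer[OF assms(3-7,12)])
    fix i assume "i \<in> supp xstar"
    then have i: "i < N" "xstar $ i \<noteq> 0" "i \<in> I" "I \<noteq> {}"
      using assms(12,14) by (auto simp: supp_def)
    show "col A i \<bullet> (A *\<^sub>v xstar - y) + lam * q * sgn (xstar $ i) * \<bar>xstar $ i\<bar> powr (q - 1) = 0"
      using ccd_limit_stationary[OF assms(3-5) assms(9,6-8,12,13) i(1,2)] .
    have e: "e = Min ((\<lambda>i. \<bar>xstar $ i\<bar>) ` I)" using assms(16) i(4) by simp
    have "e \<in> (\<lambda>i. \<bar>xstar $ i\<bar>) ` I"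
      unfolding e using fin i by (intro Min_in) auto
    then have e_pos: "0 < e"
      using assms(14) by (auto simp: supp_def)
    have "e \<le> \<bar>xstar $ i\<bar>"
      unfolding e using fin i by simp
    \<comment> \<open>Since \<open>2 - q > 0\<close>, condition (b), stated for the smallest entry,
      transfers to every entry of the support.\<close>
    then have "e powr (2 - q) \<le> \<bar>xstar $ i\<bar> powr (2 - q)"
      using e_pos assms(7) by (intro powr_mono2) auto
    moreover have "lam * (q * (1 - q)) < sg * e powr (2 - q)" "0 < sg"
      using assms(6,7,17,18) i(4) e_pos by (auto simp: sg_def field_simps)
    ultimately have "lam * (q * (1 - q)) < sg * \<bar>xstar $ i\<bar> powr (2 - q)"
      by (meson less_le_trans mult_left_mono less_imp_le)
    then have "lam * (q * (1 - q)) * \<bar>xstar $ i\<bar> powr (q - 2)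
      < sg * \<bar>xstar $ i\<bar> powr (2 - q) * \<bar>xstar $ i\<bar> powr (q - 2)"
      using i(2) by (intro mult_strict_right_mono) auto
    also have "\<dots> = sg"
      using i(2) by (simp add: mult.assoc flip: powr_add)
    finally show "lam * q * (1 - q) * \<bar>xstar $ i\<bar> powr (q - 2) < sg"
      by (simp add: mult.assoc)
  next
    fix h :: "real vec" assume h: "h \<in> carrier_vec N" "\<And>i. i < N \<Longrightarrow> i \<notin> supp xstar \<Longrightarrow> h $ i = 0"
    show "sg * (\<Sum>i\<in>supp xstar. (h $ i)\<^sup>2) \<le> (A *\<^sub>v h) \<bullet> (A *\<^sub>v h)"
    \<comment> \<open>For an empty support the left side is an empty sum, so the value of
      \<open>sigma_min\<close> on an empty Gram matrix does not enter.\<close>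
    proof (cases "I = {}")
      case True
      then show ?thesis
        using assms(14) scalar_prod_self_nonneg[of "A *\<^sub>v h"] by simp
    next
      case False
      show ?thesis
        using sigma_min_le_norm_square[OF assms(3) I False h(1)] h(2) by (simp add: sg_def assms(14))
    qed
  qed
qed

end
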